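(* Let $k\ge 1$, let $A=\{a_0,a_1,\ldots,a_{k-1}\}$ be a set of integers with $a_0<a_1<\cdots<a_{k-1}$, let $\mathbf{r}=(r_0,r_1,\ldots,r_{k-1})$ be an ordered $k$-tuple of positive integers, and let $h$ be an integer with $2\le h\le \sum_{j=0}^{k-1} r_j$. Then $$|h^{(\mathbf{r})}A|\ge L(\mathbf{r},h).$$ Moreover, this lower bound is best possible: for every such $\mathbf{r}$ and $h$ there exists a set $A$ of $k$ integers (for instance $A=\{0,1,\ldots,k-1\}$) with $|h^{(\mathbf{r})}A|=L(\mathbf{r},h)$.
   Context: For a set $A=\{a_0,\ldots,a_{k-1}\}$ of integers, a $k$-tuple $\mathbf{r}=(r_0,\ldots,r_{k-1})$ of positive integers and a positive integer $h$, define the general $h$-fold sumset $$h^{(\mathbf{r})}A=\Big\{\sum_{i=0}^{k-1}s_ia_i:\ s_i\in\mathbb{Z},\ 0\le s_i\le r_i\ (0\le i\le k-1),\ \sum_{i=0}^{k-1}s_i=h\Big\}.$$ Empty sums are $0$. Let $I_{\mathbf{r}}(h)$ be the largest integer (with $0\le I_{\mathbf{r}}(h)\le k$) such that $\sum_{j=0}^{I_{\mathbf{r}}(h)-1}r_j\le h$, and $M_{\mathbf{r}}(h)$ the least integer (with $-1\le M_{\mathbf{r}}(h)\le k-1$) such that $\sum_{j=M_{\mathbf{r}}(h)+1}^{k-1}r_j\le h$. Put $\delta_{\mathbf{r}}(h)=h-\sum_{j=0}^{I_{\mathbf{r}}(h)-1}r_j$ and $\theta_{\mathbf{r}}(h)=h-\sum_{j=M_{\mathbf{r}}(h)+1}^{k-1}r_j$,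 and $$L(\mathbf{r},h)=\sum_{j=M_{\mathbf{r}}(h)+1}^{k-1}j r_j-\sum_{j=0}^{I_{\mathbf{r}}(h)-1}j r_j+M_{\mathbf{r}}(h)\,\theta_{\mathbf{r}}(h)-I_{\mathbf{r}}(h)\,\delta_{\mathbf{r}}(h)+1.$$ *)

theory Defs
  imports Main
begin

text \<open>
  A set \<open>A = {a_0, ..., a_{k-1}}\<close> together with the tuple \<open>r = (r_0, ..., r_{k-1})\<close> is given by
  \<open>k\<close> and functions \<open>a\<close>, \<open>r\<close> on the naturals, of which only the values at indices below \<open>k\<close>
  are used. The enumeration \<open>a\<close> is a parameter because \<open>r i\<close> bounds the multiplicity of \<open>a i\<close>.
\<close>

definition gen_sumset :: "nat \<Rightarrow> (nat \<Rightarrow> int) \<Rightarrow> (nat \<Rightarrow> nat) \<Rightarrow> nat \<Rightarrow> int set" where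
  "gen_sumset k a r h =
     {(\<Sum>i<k. int (s i) * a i) | s :: nat \<Rightarrow> nat. (\<forall>i<k. s i \<le> r i) \<and> (\<Sum>i<k. s i) = h}"

definition I_idx :: "nat \<Rightarrow> (nat \<Rightarrow> nat) \<Rightarrow> nat \<Rightarrow> nat" where
  "I_idx k r h = Max {i \<in> {0..k}. (\<Sum>j<i. r j) \<le> h}"

text \<open>
  The index \<open>M\<close> is an integer since it may be \<open>-1\<close>; in that range \<open>nat (m + 1)\<close> is \<open>m + 1\<close>.
  Both sets of candidate indices are finite and nonempty: they contain \<open>0\<close> and \<open>k - 1\<close>, respectively.
\<close>

definition M_idx :: "nat \<Rightarrow> (nat \<Rightarrow> nat) \<Rightarrow> nat \<Rightarrow> int" where
  "M_idx k r h = Min {m \<in> {-1..int k - 1}. (\<Sum>j = nat (m + 1)..<k. r j) \<le> h}"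

definition delta :: "nat \<Rightarrow> (nat \<Rightarrow> nat) \<Rightarrow> nat \<Rightarrow> int" where
  "delta k r h = int h - (\<Sum>j<I_idx k r h. int (r j))"

definition theta :: "nat \<Rightarrow> (nat \<Rightarrow> nat) \<Rightarrow> nat \<Rightarrow> int" where
  "theta k r h = int h - (\<Sum>j = nat (M_idx k r h + 1)..<k. int (r j))"

definition L_bound :: "nat \<Rightarrow> (nat \<Rightarrow> nat) \<Rightarrow> nat \<Rightarrow> int" where
  "L_bound k r h =
     (\<Sum>j = nat (M_idx k r h + 1)..<k. int j * int (r j))
     - (\<Sum>j<I_idx k r h. int j * int (r j))
     + M_idx k r h * theta k r h - int (I_idx k r h) * delta k r h + 1"

end

theory Submission
  imports Defs
begin

text \<open>
  Call \<open>\<Sum>i<k. i * s i\<close> the weight of an admissible tuple \<open>s\<close>. Moving one unit from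
  position \<open>i\<close> to position \<open>i + 1\<close>, when this keeps \<open>s\<close> admissible, raises the weight by
  exactly one and strictly raises \<open>\<Sum>i<k. s i * a i\<close>. Since all \<open>r i\<close> are positive, the only
  tuple allowing no such move has its mass pushed as far to the right as possible, and it has the
  maximal weight. Dually, the leftmost tuple has the minimal weight. Climbing from the leftmost to
  the rightmost tuple produces \<open>L(r, h)\<close> distinct elements of the sumset, and for \<open>a i = i\<close> the
  elements of the sumset are themselves weights, so there are no others.
\<close>

section \<open>Weights, finiteness of the sumset, and recognition of the indices M and I\<close>

definition admissible :: "nat \<Rightarrow> (nat \<Rightarrow> nat) \<Rightarrow> nat \<Rightarrow> (nat \<Rightarrow> nat) \<Rightarrow> bool" where
  "admissible k r h s \<longleftrightarrow> (\<forall>i<k. s i \<le> r i) \<and> (\<Sum>i<k. s i) = h"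

definition val :: "nat \<Rightarrow> (nat \<Rightarrow> int) \<Rightarrow> (nat \<Rightarrow> nat) \<Rightarrow> int" where
  "val k a s = (\<Sum>i<k. int (s i) * a i)"

text \<open>For \<open>h\<close> at most the total capacity, this is the weight of the rightmost
  tuple: every position above M is filled to capacity and the remaining \<open>theta\<close> units
  sit at M. Dually, \<open>min_weight\<close> fills the positions below I and puts
  \<open>delta\<close> units at I.\<close>

definition max_weight :: "nat \<Rightarrow> (nat \<Rightarrow> nat) \<Rightarrow> nat \<Rightarrow> int" where
  "max_weight k r h =
     (\<Sum>j = nat (M_idx k r h + 1)..<k. int j * int (r j)) + M_idx k r h * theta k r h"

definition min_weight :: "nat \<Rightarrow> (nat \<Rightarrow> nat) \<Rightarrow> nat \<Rightarrow> int" where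
  "min_weight k r h =
     (\<Sum>j<I_idx k r h. int j * int (r j)) + int (I_idx k r h) * delta k r h"

lemma L_bound_eq: "L_bound k r h = max_weight k r h - min_weight k r h + 1"
  by (simp add: L_bound_def max_weight_def min_weight_def)

lemma gen_sumset_eq: "gen_sumset k a r h = val k a ` {s. admissible k r h s}"
  by (auto simp: gen_sumset_def val_def admissible_def)

lemma val_in_gen_sumset: "admissible k r h s \<Longrightarrow> val k a s \<in> gen_sumset k a r h"
  by (simp add: gen_sumset_eq)

text \<open>Tuples are functions on all naturals, unconstrained from \<open>k\<close> on, so there
  are infinitely many of them. Finiteness therefore comes from bounding the values by the triangle
  inequality.\<close>

lemma finite_gen_sumset: "finite (gen_sumset k a r h)"
proof (rule finite_subset)
  define B where "B = (\<Sum>i<k. int (r i) * \<bar>a i\<bar>)"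
  show "gen_sumset k a r h \<subseteq> {-B..B}"
  proof
    fix x assume "x \<in> gen_sumset k a r h"
    then obtain s where s: "\<forall>i<k. s i \<le> r i" and x: "x = (\<Sum>i<k. int (s i) * a i)"
      by (auto simp: gen_sumset_def)
    have "\<bar>x\<bar> \<le> (\<Sum>i<k. \<bar>int (s i) * a i\<bar>)"
      unfolding x by (rule sum_abs)
    also have "\<dots> \<le> B"
      unfolding B_def using s by (intro sum_mono) (auto simp: abs_mult intro!: mult_right_mono)
    finally show "x \<in> {-B..B}" by auto
  qed
qed simp

text \<open>The natural number \<open>c\<close> stands for M + 1, the start of the tail. Tail sums
  only grow as the start moves left, so failure at \<open>c - 1\<close> excludes every smaller
  candidate. For \<open>c = 0\<close>, M is -1 and nothing has to be excluded.\<close>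

lemma M_idx_eqI:
  assumes "c \<le> k" and "(\<Sum>j = c..<k. r j) \<le> h"
    and "c > 0 \<Longrightarrow> h < (\<Sum>j = c - 1..<k. r j)"
  shows "M_idx k r h = int c - 1"
  unfolding M_idx_def
proof (rule Min_eqI)
  show "finite {m \<in> {-1..int k - 1}. (\<Sum>j = nat (m + 1)..<k. r j) \<le> h}"
    by (rule finite_subset[of _ "{-1..int k - 1}"]) (blast, rule finite_atLeastAtMost_int)
  show "int c - 1 \<in> {m \<in> {-1..int k - 1}. (\<Sum>j = nat (m + 1)..<k. r j) \<le> h}"
    using assms by auto
next
  fix m assume m: "m \<in> {m \<in> {-1..int k - 1}. (\<Sum>j = nat (m + 1)..<k. r j) \<le> h}"
  show "int c - 1 \<le> m"
  proof (rule ccontr)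
    assume "\<not> int c - 1 \<le> m"
    then have "c > 0" and "nat (m + 1) \<le> c - 1" using m by auto
    then have "(\<Sum>j = c - 1..<k. r j) \<le> (\<Sum>j = nat (m + 1)..<k. r j)"
      by (intro sum_mono2) auto
    then show False using m assms(3) \<open>c > 0\<close> by auto
  qed
qed

lemma I_idx_eqI:
  assumes "d \<le> k" and "(\<Sum>j<d. r j) \<le> h" and "d < k \<Longrightarrow> h < (\<Sum>j<Suc d. r j)"
  shows "I_idx k r h = d"
  unfolding I_idx_def
proof (rule Max_eqI)
  fix i assume i: "i \<in> {i \<in> {0..k}. (\<Sum>j<i. r j) \<le> h}"
  show "i \<le> d"
  proof (rule ccontr)
    assume "\<not> i \<le> d"
    then have "(\<Sum>j<Suc d. r j) \<le> (\<Sum>j<i. r j)"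
      by (intro sum_mono2) auto
    then show False using i assms(3) \<open>\<not> i \<le> d\<close> by auto
  qed
qed (use assms in auto)

section \<open>The extremal tuples\<close>

lemma sum_split_at:
  fixes f :: "nat \<Rightarrow> 'a::comm_monoid_add"
  assumes "m < k"
  shows "(\<Sum>i<k. f i) = (\<Sum>i<m. f i) + (f m + (\<Sum>i = Suc m..<k. f i))"
proof -
  have "{..<k} = {..<m} \<union> {m..<k}" using assms by auto
  moreover have "sum f ({..<m} \<union> {m..<k}) = sum f {..<m} + sum f {m..<k}"
    by (rule sum.union_disjoint) auto
  ultimately show ?thesis using sum.atLeast_Suc_lessThan[OF assms, of f] by simp
qed

text \<open>Right of the first occupied position, fullness propagates: a full position is nonempty
  because \<open>r\<close> is positive, so \<open>stuck\<close> forces its right neighbour to be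
  full too. Thus only the first occupied position can be partly filled.\<close>

lemma val_rightmost:
  assumes adm: "admissible k r h s"
    and r: "\<And>i. i < k \<Longrightarrow> r i > 0" and "h > 0"
    and stuck: "\<And>i. Suc i < k \<Longrightarrow> s i > 0 \<Longrightarrow> s (Suc i) = r (Suc i)"
  shows "val k int s = max_weight k r h"
proof -
  have h: "(\<Sum>i<k. s i) = h" and le: "\<And>i. i < k \<Longrightarrow> s i \<le> r i"
    using adm by (auto simp: admissible_def)
  have ex: "\<exists>m. m < k \<and> s m > 0"
    using h \<open>h > 0\<close> by (metis bot_nat_0.not_eq_extremum lessThan_iff sum.neutral)
  define m where "m = (LEAST m. m < k \<and> s m > 0)"
  have m: "m < k" "s m > 0"
    using LeastI_ex[OF ex] by (auto simp: m_def)
  have low: "s i = 0" if "i < m" for i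
    using not_less_Least[of i "\<lambda>m. m < k \<and> s m > 0"] that m by (auto simp: m_def)
  have high: "s i = r i" if "m < i" "i < k" for i
    using that
  proof (induction i)
    case (Suc i)
    have "s i > 0"
      using Suc m r[of i] by (cases "i = m") auto
    then show ?case using stuck Suc by simp
  qed simp
  have hs: "h = s m + (\<Sum>j = Suc m..<k. r j)"
    using sum_split_at[OF m(1), of s] h low high by simp
  have v: "val k int s = int (s m) * int m + (\<Sum>j = Suc m..<k. int j * int (r j))"
    using sum_split_at[OF m(1), of "\<lambda>i. int (s i) * int i"] low high
    by (simp add: val_def mult.commute)
  show ?thesis
  \<comment> \<open>A partly filled \<open>m\<close> is M itself, with \<open>theta\<close> equal to
    \<open>s m\<close>. If \<open>m\<close> is full, M drops to \<open>m - 1\<close> (possibly -1)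
    and \<open>theta\<close> is 0; for positive \<open>m\<close>, M is no smaller because
    \<open>r (m - 1)\<close> is positive.\<close>
  proof (cases "s m < r m")
    case True
    then have "M_idx k r h = int (Suc m) - 1"
      using m hs sum.atLeast_Suc_lessThan[OF m(1), of r] by (intro M_idx_eqI) auto
    then show ?thesis
      using hs v by (simp add: max_weight_def theta_def nat_add_distrib)
  next
    case False
    then have eq: "s m = r m" using le m by (simp add: le_antisym)
    have hr: "h = (\<Sum>j = m..<k. r j)" using hs eq sum.atLeast_Suc_lessThan[OF m(1), of r] by simp
    have "M_idx k r h = int m - 1"
      using m hr r[of "m - 1"] sum.atLeast_Suc_lessThan[of "m - 1" k r]
      by (intro M_idx_eqI) auto
    then show ?thesis
      using v eq hr sum.atLeast_Suc_lessThan[OF m(1), of "\<lambda>j. int j * int (r j)"]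
      by (simp add: max_weight_def theta_def)
  qed
qed

text \<open>Mirror image: from the last occupied position \<open>m\<close>, fullness propagates
  downwards. I counts the full initial positions, so it is \<open>m\<close> when \<open>m\<close> is
  partly filled, and \<open>Suc m\<close> with \<open>delta\<close> equal to 0 when \<open>m\<close>
  is full.\<close>

lemma val_leftmost:
  assumes adm: "admissible k r h s"
    and r: "\<And>i. i < k \<Longrightarrow> r i > 0" and "h > 0"
    and stuck: "\<And>i. Suc i < k \<Longrightarrow> s (Suc i) > 0 \<Longrightarrow> s i = r i"
  shows "val k int s = min_weight k r h"
proof -
  have h: "(\<Sum>i<k. s i) = h" and le: "\<And>i. i < k \<Longrightarrow> s i \<le> r i"
    using adm by (auto simp: admissible_def)
  have ex: "\<exists>m. m < k \<and> s m > 0"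
    using h \<open>h > 0\<close> by (metis bot_nat_0.not_eq_extremum lessThan_iff sum.neutral)
  define m where "m = (GREATEST m. m < k \<and> s m > 0)"
  have m: "m < k" "s m > 0"
    using GreatestI_ex_nat[OF ex, of k] by (auto simp: m_def)
  have high: "s i = 0" if "m < i" "i < k" for i
    using Greatest_le_nat[of "\<lambda>m. m < k \<and> s m > 0" i k] that by (auto simp: m_def)
  have low: "s i = r i" if "i < m" for i
    using less_imp_le_nat[OF that] that
  proof (induction i rule: inc_induct)
    case (step i)
    have "s (Suc i) > 0"
      using step m r[of "Suc i"] by (cases "Suc i = m") auto
    then show ?case using stuck step m by simp
  qed simp
  have hs: "h = (\<Sum>j<m. r j) + s m"
    using sum_split_at[OF m(1), of s] h low high by simp
  have v: "val k int s = (\<Sum>j<m. int j * int (r j)) + int (s m) * int m"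
    using sum_split_at[OF m(1), of "\<lambda>i. int (s i) * int i"] low high
    by (simp add: val_def mult.commute)
  show ?thesis
  proof (cases "s m < r m")
    case True
    then have "I_idx k r h = m"
      using m hs by (intro I_idx_eqI) auto
    then show ?thesis
      using hs v by (simp add: min_weight_def delta_def)
  next
    case False
    then have eq: "s m = r m" using le m by (simp add: le_antisym)
    have "I_idx k r h = Suc m"
      using m hs eq r[of "Suc m"] by (intro I_idx_eqI) auto
    then show ?thesis
      using v eq hs by (simp add: min_weight_def delta_def)
  qed
qed

section \<open>Moving one unit between positions\<close>

lemma sum_move_unit:
  fixes f :: "nat \<Rightarrow> int"
  assumes "i < k" "j < k" "i \<noteq> j" "s i > 0"
  shows "(\<Sum>l<k. int ((s(i := s i - 1, j := s j + 1)) l) * f l)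
       = (\<Sum>l<k. int (s l) * f l) + (f j - f i)"
proof -
  have "(\<Sum>l<k. int ((s(i := s i - 1, j := s j + 1)) l) * f l)
      = (\<Sum>l<k. int (s l) * f l + ((if l = j then f j else 0) - (if l = i then f i else 0)))"
    using assms by (intro sum.cong) (auto simp: algebra_simps of_nat_diff)
  also have "\<dots> = (\<Sum>l<k. int (s l) * f l) + (f j - f i)"
    using assms by (simp add: sum.distrib sum_subtractf)
  finally show ?thesis .
qed

text \<open>The new tuple is chosen before \<open>a\<close>, so a single move can be tracked both in
  the weight (\<open>a = int\<close>) and in the value for the given set.\<close>

lemma move_unit:
  assumes adm: "admissible k r h s" and "i < k" "j < k" "i \<noteq> j" "s i > 0" "s j < r j"
  shows "\<exists>s'. admissible k r h s' \<and> (\<forall>a. val k a s' = val k a s + (a j - a i))"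
proof (intro exI conjI allI)
  let ?s = "s(i := s i - 1, j := s j + 1)"
  show "val k a ?s = val k a s + (a j - a i)" for a
    unfolding val_def by (rule sum_move_unit) (use assms in auto)
  \<comment> \<open>With constant coefficients 1 the change is 1 - 1, so the total is
    preserved.\<close>
  have "int (\<Sum>l<k. ?s l) = int (\<Sum>l<k. s l)"
    using sum_move_unit[of i k j s "\<lambda>_. 1"] assms by simp
  then have "(\<Sum>l<k. ?s l) = h"
    using adm by (simp only: of_nat_eq_iff admissible_def)
  moreover have "\<forall>l<k. ?s l \<le> r l"
    using assms by (auto simp: admissible_def intro: le_trans[OF diff_le_self])
  ultimately show "admissible k r h ?s"
    by (simp add: admissible_def)
qed

section \<open>The range of the weights and the climb through it\<close>

lemma admissible_exists:
  assumes "h \<le> (\<Sum>j<k. r j)"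
  shows "\<exists>s. admissible k r h s"
  using assms
proof (induction k arbitrary: h)
  case 0
  then have "admissible 0 r h r" by (simp add: admissible_def)
  then show ?case by blast
next
  case (Suc k)
  show ?case
  proof (cases "h \<le> (\<Sum>j<k. r j)")
    case True
    from Suc.IH[OF this] obtain s where "admissible k r h s" ..
    then have "admissible (Suc k) r h (s(k := 0))"
      by (auto simp: admissible_def less_Suc_eq)
    then show ?thesis by blast
  next
    case False
    then have "admissible (Suc k) r h (r(k := h - (\<Sum>j<k. r j)))"
      using Suc.prems by (auto simp: admissible_def less_Suc_eq)
    then show ?thesis by blast
  qed
qed

text \<open>For \<open>a = int\<close> the values are the weights. A tuple of largest weight admits
  no move to the right, since that would raise the weight by one, so \<open>val_rightmost\<close>
  computes its weight; the smallest weight is dual. Its attainment supplies the start of the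
  climb.\<close>

lemma gen_sumset_int_subset:
  assumes r: "\<And>i. i < k \<Longrightarrow> r i > 0" and "h > 0" and h: "h \<le> (\<Sum>j<k. r j)"
  shows "gen_sumset k int r h \<subseteq> {min_weight k r h..max_weight k r h}"
    and "min_weight k r h \<in> gen_sumset k int r h"
proof -
  let ?W = "gen_sumset k int r h"
  have W: "finite ?W" "?W \<noteq> {}"
    using admissible_exists[OF h] by (auto simp: finite_gen_sumset) (auto simp: gen_sumset_eq)
  obtain s where s: "admissible k r h s" "val k int s = Max ?W"
    using Max_in[OF W] unfolding gen_sumset_eq by auto
  have "val k int s = max_weight k r h"
  proof (rule val_rightmost[OF s(1) r \<open>h > 0\<close>])
    fix i assume i: "Suc i < k" "s i > 0"
    show "s (Suc i) = r (Suc i)"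
    proof (rule ccontr)
      assume "s (Suc i) \<noteq> r (Suc i)"
      then have "s (Suc i) < r (Suc i)"
        using s(1) i by (auto simp: admissible_def le_less)
      with i obtain s' where "admissible k r h s'"
        and "val k int s' = val k int s + (int (Suc i) - int i)"
        using move_unit[OF s(1), of i "Suc i"] by auto
      then show False
        using s(2) Max_ge[OF W(1) val_in_gen_sumset, of s'] by simp
    qed
  qed
  moreover obtain t where t: "admissible k r h t" "val k int t = Min ?W"
    using Min_in[OF W] unfolding gen_sumset_eq by auto
  have tm: "val k int t = min_weight k r h"
  proof (rule val_leftmost[OF t(1) r \<open>h > 0\<close>])
    fix i assume i: "Suc i < k" "t (Suc i) > 0"
    show "t i = r i"
    proof (rule ccontr)
      assume "t i \<noteq> r i"
      then have "t i < r i"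
        using t(1) Suc_lessD[OF i(1)] by (auto simp: admissible_def le_less)
      with i obtain t' where "admissible k r h t'"
        and "val k int t' = val k int t + (int i - int (Suc i))"
        using move_unit[OF t(1), of "Suc i" i] by auto
      then show False
        using t(2) Min_le[OF W(1) val_in_gen_sumset, of t'] by simp
    qed
  qed
  ultimately show "?W \<subseteq> {min_weight k r h..max_weight k r h}"
    using s(2) t(2) Max_ge[OF W(1)] Min_le[OF W(1)] by (intro subsetI) simp
  show "min_weight k r h \<in> ?W"
    using Min_in[OF W] t(2) tm by simp
qed

text \<open>Induction on the distance to the maximal weight. A move to the right shortens it by one,
  and the value left behind lies strictly below all those counted for the new tuple, so the count
  grows by at least one.\<close>

lemma card_gen_sumset_above:
  assumes r: "\<And>i. i < k \<Longrightarrow> r i > 0" and "h > 0" and h: "h \<le> (\<Sum>j<k. r j)"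
    and a: "strict_mono_on {..<k} a"
    and s: "admissible k r h s"
  shows "max_weight k r h - val k int s + 1
       \<le> int (card {x \<in> gen_sumset k a r h. val k a s \<le> x})"
  using s
proof (induction "nat (max_weight k r h - val k int s)" arbitrary: s rule: less_induct)
  case (less s)
  let ?X = "\<lambda>s. {x \<in> gen_sumset k a r h. val k a s \<le> x}"
  have fin: "finite (?X t)" for t by (simp add: finite_gen_sumset)
  have mem: "val k a s \<in> ?X s" using less.prems by (simp add: val_in_gen_sumset)
  show ?case
  proof (cases "\<exists>i. Suc i < k \<and> s i > 0 \<and> s (Suc i) \<noteq> r (Suc i)")
    case True
    then obtain i where i: "Suc i < k" "s i > 0" "s (Suc i) \<noteq> r (Suc i)" by blast
    then have "s (Suc i) < r (Suc i)"
      using less.prems by (auto simp: admissible_def le_less)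
    then obtain s' where s': "admissible k r h s'"
      "\<And>b. val k b s' = val k b s + (b (Suc i) - b i)"
      using move_unit[OF less.prems, of i "Suc i"] i by (metis Suc_lessD n_not_Suc_n)
    have w: "val k int s' = val k int s + 1" using s'(2)[of int] by simp
    \<comment> \<open>This bound shows that the gap at \<open>s\<close> was positive, so the
      measure, truncated by \<open>nat\<close>, really decreases.\<close>
    have "val k int s' \<le> max_weight k r h"
      using gen_sumset_int_subset(1)[OF r \<open>h > 0\<close> h] s'(1) by (auto simp: gen_sumset_eq)
    then have IH: "max_weight k r h - val k int s' + 1 \<le> int (card (?X s'))"
      using less.hyps[OF _ s'(1)] w by simp
    have lt: "val k a s < val k a s'"
      using s'(2)[of a] strict_mono_onD[OF a, of i "Suc i"] i by simp
    then have "insert (val k a s) (?X s') \<subseteq> ?X s" using mem by auto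
    then have "card (insert (val k a s) (?X s')) \<le> card (?X s)"
      by (rule card_mono[OF fin])
    moreover have "card (insert (val k a s) (?X s')) = Suc (card (?X s'))"
      using lt fin by (intro card_insert_disjoint) auto
    ultimately show ?thesis using IH w by simp
  next
    case False
    \<comment> \<open>With no move available the climb is over: the claim asks for just one element,
      and the value of \<open>s\<close> itself is one.\<close>
    then have "val k int s = max_weight k r h"
      using val_rightmost[OF less.prems r \<open>h > 0\<close>] by blast
    moreover have "card (?X s) > 0" using mem fin by (auto simp: card_gt_0_iff)
    ultimately show ?thesis by simp
  qed
qed

lemma L_bound_le_card_gen_sumset:
  assumes r: "\<And>i. i < k \<Longrightarrow> r i > 0" and "h > 0" and h: "h \<le> (\<Sum>j<k. r j)"
    and a: "strict_mono_on {..<k} a"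
  shows "L_bound k r h \<le> int (card (gen_sumset k a r h))"
proof -
  obtain s where s: "admissible k r h s" "val k int s = min_weight k r h"
    using gen_sumset_int_subset(2)[OF r \<open>h > 0\<close> h] by (auto simp: gen_sumset_eq)
  have "L_bound k r h \<le> int (card {x \<in> gen_sumset k a r h. val k a s \<le> x})"
    using card_gen_sumset_above[OF r \<open>h > 0\<close> h a s(1)] s(2) by (simp add: L_bound_eq)
  also have "\<dots> \<le> int (card (gen_sumset k a r h))"
    by (simp add: card_mono finite_gen_sumset)
  finally show ?thesis .
qed

theorem theorem1:
  fixes k h :: nat and r :: "nat \<Rightarrow> nat"
  assumes "k \<ge> 1"
    and "\<And>i. i < k \<Longrightarrow> r i > 0"
    and "2 \<le> h" and "h \<le> (\<Sum>j<k. r j)"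
  shows "(\<forall>a :: nat \<Rightarrow> int. strict_mono_on {..<k} a \<longrightarrow>
            int (card (gen_sumset k a r h)) \<ge> L_bound k r h)
       \<and> (\<exists>a :: nat \<Rightarrow> int. strict_mono_on {..<k} a \<and>
            int (card (gen_sumset k a r h)) = L_bound k r h)
       \<and> int (card (gen_sumset k (\<lambda>i. int i) r h)) = L_bound k r h"
proof -
  have "h > 0" using assms(3) by simp
  note lower = L_bound_le_card_gen_sumset[OF assms(2) \<open>h > 0\<close> assms(4)]
  note interval = gen_sumset_int_subset[OF assms(2) \<open>h > 0\<close> assms(4)]
  have mono: "strict_mono_on {..<k} int" by (simp add: strict_mono_on_def)
  have "card (gen_sumset k int r h) \<le> card {min_weight k r h..max_weight k r h}"
    by (rule card_mono[OF finite_atLeastAtMost_int interval(1)])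
  \<comment> \<open>Since the interval is nonempty, its cardinality is the difference of its
    endpoints plus one, without truncation at 0.\<close>
  moreover have "min_weight k r h \<le> max_weight k r h" using interval by auto
  ultimately have "int (card (gen_sumset k int r h)) \<le> L_bound k r h"
    by (simp add: L_bound_eq)
  then have "int (card (gen_sumset k int r h)) = L_bound k r h"
    using lower[OF _ mono] by simp
  then show ?thesis using lower mono by blast
qed

end
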